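(* Fix real numbers $b>a>0$. (i) If $b<10a$, then no random variable with range contained in $[a,b]$ is Benford. (ii) If $b=10a$, then there is exactly one Benford distribution with range in $[a,b]$ (that is, there is exactly one probability distribution on $\mathbb{R}$ that is the distribution of a Benford random variable with range contained in $[a,b]$). (iii) If $b>10a$, then for each $c\in(0,\,0.1b-a)$ the random variable $X_c=(a+c)\,10^{U[0,1]}$ has range contained in $[a,b]$ and is Benford; and for each $c\in(0,\,b-10a)$ the random variable $Y_c=U[a+c,\,10a+c]$ has range contained in $[a,b]$ and is not Benford.
   Context: All random variables are real-valued, and $\log$ denotes the base-10 logarithm $\log_{10}$. Significand: for real $x>0$, the (decimal) significand $S(x)$ is the unique number $t\in[1,10)$ such that $x=10^k t$ for some (necessarily unique) $k\in\mathbb{Z}$. For $x<0$, $S(x)=S(-x)$, and $S(0)=0$. Benford: a random variable $X$ is Benford if $P(S(|X|)\le t)=\log t$ for all $t\in[1,10)$. A distribution is called Benford if it is the distribution of a Benford random variable. Uniform random variables: for real numbers $p<q$, $U[p,q]$ denotes a random variable uniformly distributed on $[p,q]$, i.e. $P(U[p,q]\le x)=0$ for $x<p$, $P(U[p,q]\le x)=(x-p)/(q-p)$ for $x\in[p,q]$, and $P(U[p,q]\le x)=1$ for $x>q$. Range: a random variable $X$ (or its distribution) has range contained in $[a,b]$ if $P(a\le X\le b)=1$. *)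

theory Defs
  imports "HOL-Probability.Probability"
begin

definition significand :: "real \<Rightarrow> real" where
  "significand x =
     (if x = 0 then 0 else THE t. 1 \<le> t \<and> t < 10 \<and> (\<exists>k::int. \<bar>x\<bar> = 10 powi k * t))"

lemma significand_decomposition:
  fixes x :: real
  assumes "x \<noteq> 0"
  shows "1 \<le> 10 powr frac (log 10 \<bar>x\<bar>) \<and> 10 powr frac (log 10 \<bar>x\<bar>) < 10 \<and>
    (\<exists>k::int. \<bar>x\<bar> = 10 powi k * 10 powr frac (log 10 \<bar>x\<bar>))"
proof -
  let ?l = "log 10 \<bar>x\<bar>"
  have "\<bar>x\<bar> = 10 powr (real_of_int \<lfloor>?l\<rfloor> + frac ?l)"
    using assms by (simp add: frac_def)
  also have "\<dots> = 10 powi \<lfloor>?l\<rfloor> * 10 powr frac ?l"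
    by (simp add: powr_add powr_real_of_int')
  finally have "\<bar>x\<bar> = 10 powi \<lfloor>?l\<rfloor> * 10 powr frac ?l" .
  moreover have "10 powr frac ?l < 10 powr 1"
    by (subst powr_less_cancel_iff) (simp_all add: frac_lt_1)
  moreover have "1 \<le> (10::real) powr frac ?l"
    by (simp add: ge_one_powr_ge_zero)
  ultimately show ?thesis by auto
qed

lemma significand_unique:
  fixes x :: real
  assumes "x \<noteq> 0"
  shows "\<exists>!t. 1 \<le> t \<and> t < 10 \<and> (\<exists>k::int. \<bar>x\<bar> = 10 powi k * t)"
proof (rule ex1I)
  show "1 \<le> 10 powr frac (log 10 \<bar>x\<bar>) \<and> 10 powr frac (log 10 \<bar>x\<bar>) < 10 \<and>
      (\<exists>k::int. \<bar>x\<bar> = 10 powi k * 10 powr frac (log 10 \<bar>x\<bar>))"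
    by (rule significand_decomposition[OF assms])
next
  fix t assume t: "1 \<le> t \<and> t < 10 \<and> (\<exists>k::int. \<bar>x\<bar> = 10 powi k * t)"
  then obtain k :: int where k: "\<bar>x\<bar> = 10 powi k * t" by blast
  have "\<bar>x\<bar> = 10 powr (real_of_int k + log 10 t)"
    using t k by (simp add: powr_add powr_real_of_int')
  then have l: "log 10 \<bar>x\<bar> = real_of_int k + log 10 t"
    by simp
  have "0 \<le> log 10 t" "log 10 t < 1"
    using t by auto
  then have "frac (log 10 \<bar>x\<bar>) = log 10 t"
    unfolding l by (simp add: frac_unique_iff)
  then show "t = 10 powr frac (log 10 \<bar>x\<bar>)"
    using t by simp
qed

definition benford :: "'a measure \<Rightarrow> ('a \<Rightarrow> real) \<Rightarrow> bool" where
  "benford M X \<longleftrightarrow>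
     (\<forall>t\<in>{1..<10}. measure M {\<omega> \<in> space M. significand \<bar>X \<omega>\<bar> \<le> t} = log 10 t)"

definition range_within :: "'a measure \<Rightarrow> ('a \<Rightarrow> real) \<Rightarrow> real \<Rightarrow> real \<Rightarrow> bool" where
  "range_within M X a b \<longleftrightarrow> measure M {\<omega> \<in> space M. a \<le> X \<omega> \<and> X \<omega> \<le> b} = 1"

definition uniform_rv :: "'a measure \<Rightarrow> ('a \<Rightarrow> real) \<Rightarrow> real \<Rightarrow> real \<Rightarrow> bool" where
  "uniform_rv M U p q \<longleftrightarrow>
     distributed M lborel U (\<lambda>x. indicator {p..q} x / measure lborel {p..q})"

lemma (in prob_space) uniform_rv_iff_cdf:
  fixes p q :: real
  assumes "p < q"
  shows "uniform_rv M U p q \<longleftrightarrow> U \<in> borel_measurable M \<and>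
    (\<forall>x. prob {\<omega> \<in> space M. U \<omega> \<le> x} =
         (if x < p then 0 else if x \<le> q then (x - p) / (q - p) else 1))"
proof
  assume "uniform_rv M U p q"
  then have U [measurable]: "U \<in> borel_measurable M"
    and cdf: "\<And>t. t \<in> {p..q} \<Longrightarrow> prob {\<omega> \<in> space M. U \<omega> \<le> t} = (t - p) / (q - p)"
    unfolding uniform_rv_def uniform_distributed_iff by auto
  have "prob {\<omega> \<in> space M. U \<omega> \<le> x} = 0" if "x < p" for x
  proof -
    have "prob {\<omega> \<in> space M. U \<omega> \<le> x} \<le> prob {\<omega> \<in> space M. U \<omega> \<le> p}"
      using that by (intro finite_measure_mono) auto
    also have "\<dots> = 0" using cdf[of p] assms by simp
    finally show ?thesis by (simp add: measure_le_0_iff)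
  qed
  moreover have "prob {\<omega> \<in> space M. U \<omega> \<le> x} = 1" if "q < x" for x
  proof -
    have "1 = prob {\<omega> \<in> space M. U \<omega> \<le> q}" using cdf[of q] assms by simp
    also have "\<dots> \<le> prob {\<omega> \<in> space M. U \<omega> \<le> x}"
      using that by (intro finite_measure_mono) auto
    finally show ?thesis by (intro antisym) auto
  qed
  ultimately show "U \<in> borel_measurable M \<and>
    (\<forall>x. prob {\<omega> \<in> space M. U \<omega> \<le> x} =
         (if x < p then 0 else if x \<le> q then (x - p) / (q - p) else 1))"
    using U cdf by auto
next
  assume "U \<in> borel_measurable M \<and>
    (\<forall>x. prob {\<omega> \<in> space M. U \<omega> \<le> x} =
         (if x < p then 0 else if x \<le> q then (x - p) / (q - p) else 1))"
  then show "uniform_rv M U p q"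
    using assms unfolding uniform_rv_def uniform_distributed_iff by auto
qed

text \<open>
  HOL cannot quantify existentially over the type of the sample space, so the definition below
  takes sample spaces on the reals.  This loses no generality: by \<open>benford_distribution_distr\<close>,
  the distribution of a Benford random variable on any probability space is covered.
\<close>
definition benford_distribution :: "real measure \<Rightarrow> bool" where
  "benford_distribution D \<longleftrightarrow>
     (\<exists>(M :: real measure) X. prob_space M \<and> X \<in> borel_measurable M \<and> benford M X \<and>
        D = distr M borel X)"

lemma significand_eq:
  "significand x = (if x = 0 then 0 else 10 powr frac (log 10 \<bar>x\<bar>))"
proof (cases "x = 0")
  case False
  then show ?thesis
    using the1_equality[OF significand_unique significand_decomposition, of x]
    by (simp add: significand_def)
qed (simp add: significand_def)

lemma significand_borel [measurable]: "significand \<in> borel_measurable borel"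
proof -
  have "(\<lambda>x::real. if x = 0 then 0 else 10 powr frac (log 10 \<bar>x\<bar>)) \<in> borel_measurable borel"
    unfolding frac_def by measurable
  then show ?thesis
    by (simp add: significand_eq[abs_def])
qed

lemma benford_distr:
  assumes [measurable]: "X \<in> borel_measurable M"
  shows "benford (distr M borel X) (\<lambda>x. x) \<longleftrightarrow> benford M X"
  unfolding benford_def
  by (subst measure_distr) (auto simp: vimage_def Int_def conj_commute)

lemma range_within_distr:
  assumes [measurable]: "X \<in> borel_measurable M"
  shows "range_within (distr M borel X) (\<lambda>x. x) a b \<longleftrightarrow> range_within M X a b"
  unfolding range_within_def
  by (subst measure_distr) (auto simp: vimage_def Int_def conj_commute)

lemma benford_distribution_distr:
  fixes M :: "'a measure"
  assumes "prob_space M" and X: "X \<in> borel_measurable M" and "benford M X"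
  shows "benford_distribution (distr M borel X)"
  unfolding benford_distribution_def
proof (intro exI conjI)
  show "prob_space (distr M borel X)"
    by (rule prob_space.prob_space_distr[OF \<open>prob_space M\<close> X])
  show "benford (distr M borel X) (\<lambda>x. x)"
    using benford_distr[OF X] \<open>benford M X\<close> by simp
  show "distr M borel X = distr (distr M borel X) borel (\<lambda>x. x)"
    by (subst distr_distr) (use X in \<open>auto simp: comp_def\<close>)
qed simp

end

theory Submission
  imports Defs
begin

text \<open>
  Everything follows from scale invariance: if \<open>X\<close> is Benford and \<open>c > 0\<close>, then \<open>c X\<close> is Benford
  (\<open>benford_scale\<close>).  Multiplying \<open>X\<close> by \<open>c\<close> rotates the significand on the circle obtained from
  \<open>[1,10)\<close> by gluing its ends, and the Benford law, being Lebesgue measure on the logarithmic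
  scale, is invariant under rotation.

  Hence a Benford variable with values in an interval starting at \<open>a\<close> may be divided by \<open>a\<close>, after
  which the interval starts at 1.  On \<open>[1,10)\<close> the significand of a number is the number
  itself, so there the Benford condition prescribes the distribution function of the variable.
  If the interval is shorter than a decade, the variable exceeds its right end with
  positive probability, which is absurd (\<open>not_benford_short_range\<close>).  If the interval is exactly a
  decade, the law is determined, because the two ends, which share a significand, carry no mass
  (\<open>benford_decade_cdf\<close>); it is realised by \<open>a 10^U\<close> (\<open>benford_scaled_ten_powr_uniform\<close>).  If
  it is longer than a decade, \<open>(a + c) 10^U\<close> still works.  The variable \<open>Y\<close>, uniform on
  \<open>[a + c, 10 a + c]\<close>, cannot be Benford, since \<open>10 a + c < 10 (a + c)\<close> makes that
  interval shorter than a decade.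
\<close>

section \<open>Significands of products\<close>

lemma significand_eqI:
  assumes "1 \<le> t" "t < 10" and "\<bar>x\<bar> = 10 powi k * t"
  shows "significand x = t"
proof -
  have "x \<noteq> 0"
    using assms by auto
  then show ?thesis
    unfolding significand_def
    using the1_equality[OF significand_unique[OF \<open>x \<noteq> 0\<close>], of t] assms by auto
qed

lemma significand_self: "significand x = x" if "1 \<le> x" "x < 10"
  using that by (intro significand_eqI[where k = 0]) auto

lemma significand_ten: "significand 10 = 1"
  by (rule significand_eqI[where k = 1]) auto

lemma significand_obtain:
  assumes "x \<noteq> 0"
  obtains k where "\<bar>x\<bar> = 10 powi k * significand x" "1 \<le> significand x" "significand x < 10"
  using significand_decomposition[OF assms] assms by (auto simp: significand_eq)

lemma significand_less_ten: "significand x < 10"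
  by (cases "x = 0") (auto simp: significand_def[of 0] elim: significand_obtain)

text \<open>Multiplication is a rotation of the significand: at most one carry occurs.\<close>

lemma significand_mult:
  assumes "c \<noteq> 0" "x \<noteq> 0"
  shows "significand (c * x) =
    (if significand c * significand x < 10 then significand c * significand x
     else significand c * significand x / 10)"
proof -
  obtain j where j: "\<bar>c\<bar> = 10 powi j * significand c" "1 \<le> significand c" "significand c < 10"
    using assms(1) by (rule significand_obtain)
  obtain k where k: "\<bar>x\<bar> = 10 powi k * significand x" "1 \<le> significand x" "significand x < 10"
    using assms(2) by (rule significand_obtain)
  have cx: "\<bar>c * x\<bar> = 10 powi (j + k) * (significand c * significand x)"
    by (simp add: abs_mult j(1) k(1) power_int_add)
  have "1 * 1 \<le> significand c * significand x"
    using j k by (intro mult_mono) auto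
  moreover have "significand c * significand x < 10 * 10"
    using j k by (intro mult_strict_mono) auto
  moreover have carry: "\<bar>c * x\<bar> = 10 powi (j + k + 1) * (significand c * significand x / 10)"
    unfolding cx by (simp add: power_int_add)
  ultimately show ?thesis
    using significand_eqI[OF _ _ cx] significand_eqI[OF _ _ carry] by auto
qed

section \<open>Scale invariance\<close>

lemma (in prob_space) benford_AE_significand_gt_1:
  assumes [measurable]: "X \<in> borel_measurable M" and "benford M X"
  shows "AE \<omega> in M. 1 < significand \<bar>X \<omega>\<bar>"
proof -
  have "prob {\<omega> \<in> space M. significand \<bar>X \<omega>\<bar> \<le> 1} = 0"
    using assms by (simp add: benford_def)
  then have "AE \<omega> in M. \<not> significand \<bar>X \<omega>\<bar> \<le> 1"
    by (subst (asm) prob_eq_0) auto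
  then show ?thesis
    by (simp add: not_le)
qed

text \<open>A Benford significand has no atoms, its distribution function \<open>log\<close> being continuous.\<close>

lemma (in prob_space) benford_prob_less:
  assumes [measurable]: "X \<in> borel_measurable M" and X: "benford M X" and t: "1 < t" "t \<le> 10"
  shows "prob {\<omega> \<in> space M. significand \<bar>X \<omega>\<bar> < t} = log 10 t"
proof (rule antisym)
  show "prob {\<omega> \<in> space M. significand \<bar>X \<omega>\<bar> < t} \<le> log 10 t"
  proof (cases "t = 10")
    case False
    have "prob {\<omega> \<in> space M. significand \<bar>X \<omega>\<bar> < t} \<le> prob {\<omega> \<in> space M. significand \<bar>X \<omega>\<bar> \<le> t}"
      by (intro finite_measure_mono) auto
    then show ?thesis
      using X t False by (simp add: benford_def)
  qed simp
  show "log 10 t \<le> prob {\<omega> \<in> space M. significand \<bar>X \<omega>\<bar> < t}"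
  proof (rule dense_le_bounded)
    show "0 < log 10 t"
      using t by simp
    fix w assume w: "0 < w" "w < log 10 t"
    have less: "10 powr w < t"
      using w t by (simp add: less_log_iff)
    then have "w = prob {\<omega> \<in> space M. significand \<bar>X \<omega>\<bar> \<le> 10 powr w}"
      using X w t by (simp add: benford_def ge_one_powr_ge_zero)
    also have "\<dots> \<le> prob {\<omega> \<in> space M. significand \<bar>X \<omega>\<bar> < t}"
      using less by (intro finite_measure_mono) auto
    finally show "w \<le> prob {\<omega> \<in> space M. significand \<bar>X \<omega>\<bar> < t}" .
  qed
qed

text \<open>
  Outside the null set \<open>X = 0\<close>, the event \<open>S(c X) \<le> t\<close> says that the significand of \<open>X\<close> lies
  in the arc of logarithmic length \<open>log t\<close> starting at \<open>10 / S(c)\<close>, where \<open>[1,10)\<close> is seen as a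
  circle.  If \<open>t < S(c)\<close>, the arc is a single interval \<open>?R - ?L\<close>.  Otherwise it reaches the
  point where the circle was glued, and splits into the initial piece \<open>?R\<close> and the final piece
  \<open>space M - ?L\<close>.
\<close>

lemma (in prob_space) benford_scale:
  assumes [measurable]: "X \<in> borel_measurable M" and X: "benford M X" and "0 < c"
  shows "benford M (\<lambda>\<omega>. c * X \<omega>)"
  unfolding benford_def
proof
  fix t :: real assume t: "t \<in> {1..<10}"
  define d where "d = significand c"
  have d: "1 \<le> d" "d < 10"
    using \<open>0 < c\<close> significand_obtain[of c] by (auto simp: d_def)
  let ?S = "\<lambda>\<omega>. significand \<bar>X \<omega>\<bar>"
  let ?E = "{\<omega> \<in> space M. significand \<bar>c * X \<omega>\<bar> \<le> t}"
  have gt1: "AE \<omega> in M. 1 < ?S \<omega>"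
    using assms by (intro benford_AE_significand_gt_1)
  have S: "significand \<bar>c * X \<omega>\<bar> = (if d * ?S \<omega> < 10 then d * ?S \<omega> else d * ?S \<omega> / 10)"
    if "1 < ?S \<omega>" for \<omega>
    using that significand_mult[of c "\<bar>X \<omega>\<bar>"] \<open>0 < c\<close>
    by (cases "X \<omega> = 0") (auto simp: d_def abs_mult significand_def[of 0])
  show "prob ?E = log 10 t"
  proof (cases "t < d")
    case True
    let ?L = "{\<omega> \<in> space M. ?S \<omega> < 10 / d}" and ?R = "{\<omega> \<in> space M. ?S \<omega> \<le> 10 * t / d}"
    have "10 / d \<le> 10 * t / d"
      using d t by (simp add: divide_right_mono)
    then have sub: "?L \<subseteq> ?R"
      by auto
    have "AE \<omega> in M. \<omega> \<in> ?E \<longleftrightarrow> \<omega> \<in> ?R - ?L"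
      using gt1
    proof eventually_elim
      case (elim \<omega>)
      have "d * 1 < d * ?S \<omega>"
        using elim d by (intro mult_strict_left_mono) auto
      then have "significand \<bar>c * X \<omega>\<bar> \<le> t \<longleftrightarrow> 10 \<le> d * ?S \<omega> \<and> d * ?S \<omega> \<le> 10 * t"
        using S[OF elim] True by auto
      then show ?case
        using d by (auto simp: not_less pos_divide_le_eq pos_le_divide_eq mult.commute)
    qed
    then have "prob ?E = prob (?R - ?L)"
      by (intro finite_measure_eq_AE) auto
    also have "\<dots> = prob ?R - prob ?L"
      using sub by (intro finite_measure_Diff) auto
    also have "prob ?R = log 10 (10 * t / d)"
      using X d t True unfolding benford_def
      by (elim ballE[of _ _ "10 * t / d"]) (auto simp: field_simps)
    also have "prob ?L = log 10 (10 / d)"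
      using assms d t True by (intro benford_prob_less) (auto simp: field_simps)
    finally show ?thesis
      using d t by (simp add: log_divide log_mult)
  next
    case False
    let ?L = "{\<omega> \<in> space M. ?S \<omega> < 10 / d}" and ?R = "{\<omega> \<in> space M. ?S \<omega> \<le> t / d}"
    have "t / d < 10 / d"
      using d t by (simp add: divide_strict_right_mono)
    then have disj: "?R \<inter> (space M - ?L) = {}"
      by auto
    have "AE \<omega> in M. \<omega> \<in> ?E \<longleftrightarrow> \<omega> \<in> ?R \<union> (space M - ?L)"
      using gt1
    proof eventually_elim
      case (elim \<omega>)
      have "d * ?S \<omega> < d * 10"
        using significand_less_ten d by (intro mult_strict_left_mono) auto
      then have "d * ?S \<omega> \<le> t * 10"
        using False by simp
      then show ?case
        using S[OF elim] False d t by (auto simp: field_simps)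
    qed
    then have "prob ?E = prob (?R \<union> (space M - ?L))"
      by (intro finite_measure_eq_AE) auto
    also have "\<dots> = prob ?R + prob (space M - ?L)"
      using disj by (intro finite_measure_Union) auto
    also have "prob (space M - ?L) = 1 - prob ?L"
      by (intro prob_compl) auto
    also have "prob ?R = log 10 (t / d)"
      using X d t False unfolding benford_def
      by (elim ballE[of _ _ "t / d"]) (auto simp: field_simps)
    also have "prob ?L = log 10 (10 / d)"
      using assms d t by (intro benford_prob_less) (auto simp: field_simps)
    finally show ?thesis
      using d t by (simp add: log_divide)
  qed
qed

section \<open>Benford variables on at most one decade\<close>

lemma (in prob_space) range_within_iff_AE:
  assumes [measurable]: "X \<in> borel_measurable M"
  shows "range_within M X a b \<longleftrightarrow> (AE \<omega> in M. a \<le> X \<omega> \<and> X \<omega> \<le> b)"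
  unfolding range_within_def by (subst prob_Collect_eq_1) auto

text \<open>
  The only value of \<open>X / a\<close> in \<open>[1,10]\<close> that differs from its significand is 10.  Its
  significand is 1, which a Benford variable takes with probability 0.  So \<open>X / a\<close> equals its
  own significand almost surely.
\<close>

lemma (in prob_space) benford_decade_cdf:
  assumes [measurable]: "X \<in> borel_measurable M" and X: "benford M X"
    and "0 < a" and range: "range_within M X a (10 * a)"
  shows "prob {\<omega> \<in> space M. X \<omega> \<le> x} =
    (if x < a then 0 else if x < 10 * a then log 10 (x / a) else 1)"
proof -
  have "benford M (\<lambda>\<omega>. 1 / a * X \<omega>)"
    using assms by (intro benford_scale) auto
  then have Z: "benford M (\<lambda>\<omega>. X \<omega> / a)"
    by simp
  have bounds: "AE \<omega> in M. a \<le> X \<omega> \<and> X \<omega> \<le> 10 * a"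
    using range by (simp add: range_within_iff_AE)
  consider "x < a" | "a \<le> x" "x < 10 * a" | "10 * a \<le> x"
    by linarith
  then show ?thesis
  proof cases
    case 1
    have "AE \<omega> in M. \<not> X \<omega> \<le> x"
      using bounds by eventually_elim (use 1 in auto)
    then show ?thesis
      using 1 by (auto simp: prob_eq_0)
  next
    case 2
    have "AE \<omega> in M. 1 < significand \<bar>X \<omega> / a\<bar>"
      using Z by (intro benford_AE_significand_gt_1) auto
    with bounds have "AE \<omega> in M. X \<omega> \<le> x \<longleftrightarrow> significand \<bar>X \<omega> / a\<bar> \<le> x / a"
    proof eventually_elim
      case (elim \<omega>)
      then have "X \<omega> / a \<noteq> 10"
        using significand_ten by auto
      then have "significand \<bar>X \<omega> / a\<bar> = X \<omega> / a"
        using elim \<open>0 < a\<close> by (subst significand_self) (auto simp: field_simps)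
      then show ?case
        using \<open>0 < a\<close> by (simp add: divide_le_cancel)
    qed
    then have "prob {\<omega> \<in> space M. X \<omega> \<le> x} = prob {\<omega> \<in> space M. significand \<bar>X \<omega> / a\<bar> \<le> x / a}"
      by (intro finite_measure_eq_AE) auto
    also have "\<dots> = log 10 (x / a)"
      using Z 2 \<open>0 < a\<close> unfolding benford_def
      by (elim ballE[of _ _ "x / a"]) (auto simp: pos_divide_less_eq)
    finally show ?thesis
      using 2 by simp
  next
    case 3
    have "AE \<omega> in M. X \<omega> \<le> x"
      using bounds by eventually_elim (use 3 in auto)
    then show ?thesis
      using 3 \<open>0 < a\<close> by (auto simp: prob_Collect_eq_1)
  qed
qed

text \<open>
  The distribution function on the full decade gives \<open>X \<le> b\<close> probability \<open>log (b / a) < 1\<close>.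
\<close>

lemma (in prob_space) not_benford_short_range:
  assumes [measurable]: "X \<in> borel_measurable M"
    and "0 < a" "a < b" "b < 10 * a" and range: "range_within M X a b"
  shows "\<not> benford M X"
proof
  assume X: "benford M X"
  have ab: "AE \<omega> in M. a \<le> X \<omega> \<and> X \<omega> \<le> b"
    using range by (simp add: range_within_iff_AE)
  then have "AE \<omega> in M. X \<omega> \<le> b"
    by eventually_elim simp
  then have "prob {\<omega> \<in> space M. X \<omega> \<le> b} = 1"
    by (subst prob_Collect_eq_1) auto
  moreover have "range_within M X a (10 * a)"
    unfolding range_within_iff_AE[OF assms(1)] using ab
    by eventually_elim (use \<open>b < 10 * a\<close> in auto)
  then have "prob {\<omega> \<in> space M. X \<omega> \<le> b} = log 10 (b / a)"
    using assms X by (subst benford_decade_cdf[of _ a]) auto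
  moreover have "log 10 (b / a) < log 10 10"
    using assms by (subst log_less_cancel_iff) (auto simp: field_simps)
  ultimately show False
    by simp
qed

lemma benford_distribution_decade_unique:
  assumes "0 < a"
    and "benford_distribution D" "range_within D (\<lambda>x. x) a (10 * a)"
    and "benford_distribution D'" "range_within D' (\<lambda>x. x) a (10 * a)"
  shows "D = D'"
proof -
  have *: "real_distribution E \<and>
      cdf E = (\<lambda>x. if x < a then 0 else if x < 10 * a then log 10 (x / a) else 1)"
    if E: "benford_distribution E" "range_within E (\<lambda>x. x) a (10 * a)" for E
  proof -
    obtain N :: "real measure" and X where N: "prob_space N" "X \<in> borel_measurable N"
      "benford N X" "E = distr N borel X"
      using E by (auto simp: benford_distribution_def)
    interpret N: prob_space N by fact
    have "cdf E x = measure N {\<omega> \<in> space N. X \<omega> \<le> x}" for x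
      using N unfolding cdf_def \<open>E = _\<close>
      by (subst measure_distr) (auto simp: vimage_def Int_def conj_commute)
    moreover have "range_within N X a (10 * a)"
      using E N by (simp add: range_within_distr)
    ultimately show ?thesis
      using N \<open>0 < a\<close> by (auto simp: N.benford_decade_cdf intro: N.real_distribution_distr)
  qed
  show ?thesis
    using *[OF assms(2,3)] *[OF assms(4,5)] by (intro cdf_unique) auto
qed

section \<open>Powers of ten with a uniform exponent\<close>

lemma (in prob_space) uniform_rv_range_within:
  assumes "p < q" and U: "uniform_rv M U p q"
  shows "range_within M U p q"
proof -
  have [measurable]: "U \<in> borel_measurable M"
    using assms by (simp add: uniform_rv_iff_cdf)
  have "prob {\<omega> \<in> space M. U \<omega> \<le> p} = 0" "prob {\<omega> \<in> space M. U \<omega> \<le> q} = 1"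
    using assms by (auto simp: uniform_rv_iff_cdf)
  then have "AE \<omega> in M. \<not> U \<omega> \<le> p" "AE \<omega> in M. U \<omega> \<le> q"
    by (auto simp: prob_eq_0 prob_Collect_eq_1)
  then have "AE \<omega> in M. p \<le> U \<omega> \<and> U \<omega> \<le> q"
    by eventually_elim auto
  then show ?thesis
    by (simp add: range_within_iff_AE)
qed

lemma (in prob_space) benford_scaled_ten_powr_uniform:
  assumes U: "uniform_rv M U 0 1" and "0 < d"
  shows "benford M (\<lambda>\<omega>. d * 10 powr U \<omega>)"
proof -
  have [measurable]: "U \<in> borel_measurable M"
    using U by (simp add: uniform_rv_iff_cdf)
  have cdf: "prob {\<omega> \<in> space M. U \<omega> \<le> x} = x" if "0 \<le> x" "x \<le> 1" for x
    using U that by (simp add: uniform_rv_iff_cdf)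
  have bounds: "AE \<omega> in M. 0 \<le> U \<omega> \<and> U \<omega> \<le> 1"
    using uniform_rv_range_within[OF _ U] by (simp add: range_within_iff_AE)
  have prob_less_1: "prob {\<omega> \<in> space M. U \<omega> < 1} = 1"
  proof (rule antisym)
    show "1 \<le> prob {\<omega> \<in> space M. U \<omega> < 1}"
    proof (rule dense_le_bounded[of 0])
      fix w :: real assume w: "0 < w" "w < 1"
      then have "w = prob {\<omega> \<in> space M. U \<omega> \<le> w}"
        by (simp add: cdf)
      also have "\<dots> \<le> prob {\<omega> \<in> space M. U \<omega> < 1}"
        using w by (intro finite_measure_mono) auto
      finally show "w \<le> prob {\<omega> \<in> space M. U \<omega> < 1}" .
    qed simp
  qed simp
  \<comment> \<open>The exponent 1 has to be excluded, because \<open>10 powr 1\<close> is not its own significand.\<close>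
  have less_1: "AE \<omega> in M. U \<omega> < 1"
    using prob_less_1 by (subst (asm) prob_Collect_eq_1) auto
  have "benford M (\<lambda>\<omega>. 10 powr U \<omega>)"
    unfolding benford_def
  proof
    fix t :: real assume t: "t \<in> {1..<10}"
    have "AE \<omega> in M. significand \<bar>10 powr U \<omega>\<bar> \<le> t \<longleftrightarrow> U \<omega> \<le> log 10 t"
      using bounds less_1
    proof eventually_elim
      case (elim \<omega>)
      have "10 powr U \<omega> < 10 powr 1"
        using elim by (subst powr_less_cancel_iff) auto
      then have "significand \<bar>10 powr U \<omega>\<bar> = 10 powr U \<omega>"
        using elim by (subst significand_self) (auto simp: ge_one_powr_ge_zero)
      then show ?case
        using t by (simp add: le_log_iff)
    qed
    then have "prob {\<omega> \<in> space M. significand \<bar>10 powr U \<omega>\<bar> \<le> t} =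
        prob {\<omega> \<in> space M. U \<omega> \<le> log 10 t}"
      by (intro finite_measure_eq_AE) auto
    also have "\<dots> = log 10 t"
      using t by (intro cdf) auto
    finally show "prob {\<omega> \<in> space M. significand \<bar>10 powr U \<omega>\<bar> \<le> t} = log 10 t" .
  qed
  then show ?thesis
    using \<open>0 < d\<close> by (intro benford_scale) auto
qed

lemma (in prob_space) range_within_scaled_ten_powr_uniform:
  assumes U: "uniform_rv M U 0 1" and "0 < d" "a \<le> d" "10 * d \<le> b"
  shows "range_within M (\<lambda>\<omega>. d * 10 powr U \<omega>) a b"
proof -
  have [measurable]: "U \<in> borel_measurable M"
    using U by (simp add: uniform_rv_iff_cdf)
  have "AE \<omega> in M. 0 \<le> U \<omega> \<and> U \<omega> \<le> 1"
    using uniform_rv_range_within[OF _ U] by (simp add: range_within_iff_AE)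
  then have "AE \<omega> in M. a \<le> d * 10 powr U \<omega> \<and> d * 10 powr U \<omega> \<le> b"
  proof eventually_elim
    case (elim \<omega>)
    have "10 powr U \<omega> \<le> 10 powr 1"
      using elim by (intro powr_mono) auto
    then have "d \<le> d * 10 powr U \<omega>" "d * 10 powr U \<omega> \<le> 10 * d"
      using elim \<open>0 < d\<close> by (auto simp: ge_one_powr_ge_zero)
    then show ?case
      using assms by linarith
  qed
  then show ?thesis
    by (simp add: range_within_iff_AE)
qed

theorem proposition8:
  fixes a b :: real
  assumes "0 < a" and "a < b"
  shows
    "(b < 10 * a \<longrightarrow>
        \<not> (\<exists>(M :: 'a measure) X. prob_space M \<and> X \<in> borel_measurable M \<and>
              range_within M X a b \<and> benford M X))
     \<and>
     (b = 10 * a \<longrightarrow>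
        (\<exists>!D :: real measure. benford_distribution D \<and> range_within D (\<lambda>x. x) a b))
     \<and>
     (b > 10 * a \<longrightarrow>
        (\<forall>c \<in> {0<..<0.1 * b - a}. \<forall>(M :: 'a measure) U.
            prob_space M \<and> uniform_rv M U 0 1 \<longrightarrow>
              range_within M (\<lambda>\<omega>. (a + c) * 10 powr U \<omega>) a b \<and>
              benford M (\<lambda>\<omega>. (a + c) * 10 powr U \<omega>)) \<and>
        (\<forall>c \<in> {0<..<b - 10 * a}. \<forall>(M :: 'a measure) Y.
            prob_space M \<and> uniform_rv M Y (a + c) (10 * a + c) \<longrightarrow>
              range_within M Y a b \<and> \<not> benford M Y))"
proof (intro conjI impI)
  assume b: "b < 10 * a"
  show "\<not> (\<exists>(M :: 'a measure) X. prob_space M \<and> X \<in> borel_measurable M \<and>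
      range_within M X a b \<and> benford M X)"
    using prob_space.not_benford_short_range[OF _ _ assms b] by blast
next
  assume b: "b = 10 * a"
  let ?M = "uniform_measure lborel {0..1::real}"
  interpret unit: prob_space ?M
    by (rule prob_space_uniform_measure) auto
  have U: "uniform_rv ?M (\<lambda>x. x) 0 1"
    unfolding uniform_rv_def
  proof (rule unit.uniform_distrI_borel_atLeastAtMost)
    fix t :: real assume t: "0 \<le> t" "t \<le> 1"
    then have "{0..1} \<inter> {..t} = {0..t}"
      by auto
    then show "measure ?M {x \<in> space ?M. x \<le> t} = (t - 0) / (1 - 0)"
      using t by (simp flip: atMost_def)
  qed auto
  have X: "(\<lambda>x. a * 10 powr x) \<in> borel_measurable ?M"
    by simp
  show "\<exists>!D :: real measure. benford_distribution D \<and> range_within D (\<lambda>x. x) a b"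
  proof (rule ex_ex1I)
    show "\<exists>D :: real measure. benford_distribution D \<and> range_within D (\<lambda>x. x) a b"
      using benford_distribution_distr[OF unit.prob_space_axioms X]
        unit.benford_scaled_ten_powr_uniform[OF U \<open>0 < a\<close>]
        unit.range_within_scaled_ten_powr_uniform[OF U \<open>0 < a\<close>, of a b]
        range_within_distr[OF X] b
      by auto
  qed (use benford_distribution_decade_unique[OF \<open>0 < a\<close>] b in blast)
next
  assume "b > 10 * a"
  show "\<forall>c \<in> {0<..<0.1 * b - a}. \<forall>(M :: 'a measure) U.
      prob_space M \<and> uniform_rv M U 0 1 \<longrightarrow>
        range_within M (\<lambda>\<omega>. (a + c) * 10 powr U \<omega>) a b \<and>
        benford M (\<lambda>\<omega>. (a + c) * 10 powr U \<omega>)"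
    using assms
    by (auto intro!: prob_space.range_within_scaled_ten_powr_uniform
      prob_space.benford_scaled_ten_powr_uniform)
next
  assume "b > 10 * a"
  show "\<forall>c \<in> {0<..<b - 10 * a}. \<forall>(M :: 'a measure) Y.
      prob_space M \<and> uniform_rv M Y (a + c) (10 * a + c) \<longrightarrow>
        range_within M Y a b \<and> \<not> benford M Y"
  proof (intro ballI allI impI, elim conjE)
    fix c and M :: "'a measure" and Y
    assume c: "c \<in> {0<..<b - 10 * a}" and "prob_space M"
      and Y: "uniform_rv M Y (a + c) (10 * a + c)"
    interpret prob_space M by fact
    have Y_meas: "Y \<in> borel_measurable M"
      using Y assms by (simp add: uniform_rv_iff_cdf)
    have range: "range_within M Y (a + c) (10 * a + c)"
      using Y assms by (intro uniform_rv_range_within) auto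
    have "AE \<omega> in M. a \<le> Y \<omega> \<and> Y \<omega> \<le> b"
      using range[unfolded range_within_iff_AE[OF Y_meas]]
      by eventually_elim (use c in auto)
    then have "range_within M Y a b"
      by (simp add: range_within_iff_AE[OF Y_meas])
    moreover have "\<not> benford M Y"
      using range c assms by (intro not_benford_short_range[OF Y_meas, of "a + c"]) auto
    ultimately show "range_within M Y a b \<and> \<not> benford M Y" ..
  qed
qed

end
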